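(* Let $K$ be a finite simplicial complex and let $A = \{x_1, x_2, \ldots, x_n\}$ be a finite set of vertices of $K$. Let $L = \bigcup_{i=1}^n \overline{St(x_i)}$, where the stars are taken in $K$, and let $z$ be a new vertex which is not a vertex of $K$. Put $K' = K \cup (z * L)$ and $K'' = K' \setminus A$. If $L$ is contractible, then $K$, $K'$ and $K''$ are homotopy equivalent.
   Context: Simplicial complexes are abstract simplicial complexes: sets of finite non-empty sets closed under taking non-empty subsets; $\sigma \leq \tau$ means $\sigma$ is a face (non-empty subset) of $\tau$. Topological terms (contractible, homotopy equivalent) applied to a complex refer to its geometric realization $|\cdot|$. The star of a simplex $\sigma$ in $K$ is $St(\sigma) = \{\tau \in K \mid \sigma \leq \tau\}$; for a vertex $x$, $St(x)$ is the star of the simplex $[x]$. The combinatorial closure of a set $B$ of simplices of $K$ is $\overline{B} = \{\sigma \in K \mid \exists \tau \in B,\ \sigma \leq \tau\}$. Hence $\overline{St(x)}$ is a subcomplex of $K$. The simplicial cone of $L$ with apex $z$ is the simplicial join $z * L = \{[z]\} \cup L \cup \{\{z\} \cup \tau \mid \tau \in L\}$. For a complex $K'$ and a set $A$ of its vertices, $K' \setminus A$ is the subcomplex of all simplices of $K'$ containing no vertex of $A$. *)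

theory Defs
  imports "HOL-Analysis.Analysis"
begin

text \<open>Abstract complexes; the library's \<open>simplicial_complex\<close> (theory \<open>Polytope\<close>) is the geometric notion.\<close>

definition abstract_complex :: "'a set set \<Rightarrow> bool" where
  "abstract_complex K \<longleftrightarrow>
     (\<forall>\<sigma>\<in>K. finite \<sigma> \<and> \<sigma> \<noteq> {}) \<and>
     (\<forall>\<sigma>\<in>K. \<forall>\<tau>. \<tau> \<subseteq> \<sigma> \<and> \<tau> \<noteq> {} \<longrightarrow> \<tau> \<in> K)"

definition vertices :: "'a set set \<Rightarrow> 'a set" where
  "vertices K = {v. {v} \<in> K}"

text \<open>All simplices are non-empty, so the face relation between simplices of a complex is \<open>\<subseteq>\<close>.\<close>

definition star :: "'a set set \<Rightarrow> 'a set \<Rightarrow> 'a set set" where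
  "star K \<sigma> = {\<tau> \<in> K. \<sigma> \<subseteq> \<tau>}"

definition comb_closure :: "'a set set \<Rightarrow> 'a set set \<Rightarrow> 'a set set" where
  "comb_closure K B = {\<sigma> \<in> K. \<exists>\<tau>\<in>B. \<sigma> \<subseteq> \<tau>}"

definition cone_complex :: "'a \<Rightarrow> 'a set set \<Rightarrow> 'a set set" where
  "cone_complex z L = {{z}} \<union> L \<union> {{z} \<union> \<tau> | \<tau>. \<tau> \<in> L}"

definition delete_vertices :: "'a set set \<Rightarrow> 'a set \<Rightarrow> 'a set set" where
  "delete_vertices K A = {\<sigma> \<in> K. \<sigma> \<inter> A = {}}"

text \<open>
  Geometric realization by barycentric coordinates. It carries the subspace topology of the
  product topology on \<open>'a \<Rightarrow> real\<close>; for finite complexes, the only ones considered here,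
  this is the Euclidean topology and agrees with the weak (coherent) topology.
\<close>

definition realization :: "'a set set \<Rightarrow> ('a \<Rightarrow> real) set" where
  "realization K =
     {t. (\<forall>v. 0 \<le> t v) \<and> {v. t v \<noteq> 0} \<in> K \<and> (\<Sum>v | t v \<noteq> 0. t v) = 1}"

text \<open>
  The usual convention is that the empty space is not contractible, whereas the library's
  \<open>contractible {}\<close> holds.
\<close>

definition contractible_complex :: "'a set set \<Rightarrow> bool" where
  "contractible_complex K \<longleftrightarrow> realization K \<noteq> {} \<and> contractible (realization K)"

definition homotopy_equivalent_complexes :: "'a set set \<Rightarrow> 'b set set \<Rightarrow> bool" where
  "homotopy_equivalent_complexes K M \<longleftrightarrow> realization K homotopy_eqv realization M"

end

theory Submission
  imports Defs
begin

text \<open>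
  A contraction \<open>H\<close> of \<open>|L|\<close> yields a retraction of \<open>|K'|\<close> onto \<open>|K|\<close>, sending the cone
  point \<open>(1 - s) y + s z\<close> to \<open>H(s, y)\<close>. It is homotopic to the identity relative to \<open>|K|\<close>:
  first run the contraction on the base coordinate while keeping the height \<open>s\<close>, then let the
  height drop to \<open>0\<close>. Having both the contraction and the cone coordinate at hand, no homotopy
  extension property is needed.

  For \<open>K''\<close>, every simplex of \<open>K'\<close> that meets \<open>A\<close> spans a simplex together with \<open>z\<close>.
  Hence pushing the barycentric weight of \<open>A\<close> to \<open>z\<close> linearly is a deformation of \<open>|K'|\<close>
  onto \<open>|K''|\<close>.
\<close>

section \<open>General topology\<close>

text \<open>\<open>h\<close> is a homotopy from the identity to the retraction
  \<open>h (1, _)\<close>, so this retraction and the inclusion of \<open>T\<close> are inverse up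
  to homotopy. Points of \<open>T\<close> may move at intermediate times.\<close>

lemma homotopy_eqv_by_deformation:
  fixes S T :: "'a::topological_space set"
  assumes "continuous_on ({0..1} \<times> S) h" "h \<in> {0..1} \<times> S \<rightarrow> S"
    and "\<And>x. x \<in> S \<Longrightarrow> h (0::real, x) = x"
    and "\<And>x. x \<in> S \<Longrightarrow> h (1, x) \<in> T"
    and "T \<subseteq> S" "\<And>x. x \<in> T \<Longrightarrow> h (1, x) = x"
  shows "S homotopy_eqv T"
proof (rule deformation_retract_imp_homotopy_equivalent_space)
  let ?r = "\<lambda>x. h (1, x)"
  have "continuous_map (prod_topology (top_of_set {0..1}) (top_of_set S)) (top_of_set S) h"
    using assms(1,2) by auto
  then have "homotopic_with_canon (\<lambda>x. True) S S id ?r"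
    using assms(3) by (subst homotopic_with) auto
  then show "homotopic_with_canon (\<lambda>x. True) S S ?r id"
    by (rule homotopic_with_symD)
  have "continuous_on S ?r"
    by (rule continuous_on_compose2[OF assms(1)]) (auto intro!: continuous_intros)
  then show "retraction_maps (top_of_set S) (top_of_set T) ?r id"
    using assms(4-6) by (auto simp: retraction_maps_def)
qed

text \<open>The index type may be uncountable, so the function space need not be metrizable;
  separation is inherited factor by factor from the product topology.\<close>

lemma Hausdorff_space_euclidean_fun:
  "Hausdorff_space (euclidean :: ('a \<Rightarrow> 'b::metric_space) topology)"
  unfolding euclidean_product_topology[symmetric] Hausdorff_space_product_topology
  using Hausdorff_space_euclidean by auto

text \<open>A continuous surjection from a compact space onto a Hausdorff space is closed, hence a
  quotient map, so continuity of \<open>f\<close> can be tested after composing with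
  \<open>q\<close>.\<close>

lemma continuous_on_compact_quotient:
  fixes q :: "'a::topological_space \<Rightarrow> 'b::topological_space"
    and f :: "'b \<Rightarrow> 'c::topological_space"
  assumes "compact S" "continuous_on S q" "q ` S = T"
    and "Hausdorff_space (euclidean :: 'b topology)"
    and "continuous_on S (f \<circ> q)"
  shows "continuous_on T f"
proof -
  have "quotient_map (top_of_set S) (top_of_set T) q"
    using assms(1-4)
    by (intro continuous_imp_quotient_map)
       (auto simp: Hausdorff_space_subtopology compact_space_subtopology)
  then show ?thesis
    using continuous_compose_quotient_map[of "top_of_set S" "top_of_set T" q euclidean f] assms(5)
    by simp
qed

section \<open>Realizations\<close>

lemma abstract_complex_face:
  assumes "abstract_complex K" "\<sigma> \<in> K" "\<tau> \<subseteq> \<sigma>" "\<tau> \<noteq> {}"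
  shows "\<tau> \<in> K"
proof -
  have "\<forall>\<sigma>\<in>K. \<forall>\<tau>. \<tau> \<subseteq> \<sigma> \<and> \<tau> \<noteq> {} \<longrightarrow> \<tau> \<in> K"
    using assms(1) unfolding abstract_complex_def ..
  from this[rule_format, OF assms(2)] show ?thesis using assms(3,4) by iprover
qed

lemma abstract_complexI:
  assumes "\<And>\<sigma>. \<sigma> \<in> K \<Longrightarrow> finite \<sigma>" "{} \<notin> K"
    and "\<And>\<sigma> \<tau>. \<sigma> \<in> K \<Longrightarrow> \<tau> \<subseteq> \<sigma> \<Longrightarrow> \<tau> \<noteq> {} \<Longrightarrow> \<tau> \<in> K"
  shows "abstract_complex K"
  unfolding abstract_complex_def
proof (intro conjI ballI allI impI)
  show "\<sigma> \<noteq> {}" if "\<sigma> \<in> K" for \<sigma>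
    using that assms(2) by metis
  show "\<tau> \<in> K" if "\<sigma> \<in> K" "\<tau> \<subseteq> \<sigma> \<and> \<tau> \<noteq> {}" for \<sigma> \<tau>
    using that assms(3) by simp
qed (fact assms(1))

lemma abstract_complex_simplex:
  assumes "abstract_complex K"
  shows "\<sigma> \<in> K \<Longrightarrow> finite \<sigma>" "{} \<notin> K"
  using assms unfolding abstract_complex_def by metis+

text \<open>The support of \<open>t\<close> is a face of the carrier \<sigma>, non-empty because the
  coordinates sum to 1. Allowing a carrier larger than the support spares case distinctions when
  coordinates degenerate to 0.\<close>

lemma realizationI:
  assumes "abstract_complex K" "\<sigma> \<in> K" "\<And>v. 0 \<le> t v" "\<And>v. v \<notin> \<sigma> \<Longrightarrow> t v = 0" "sum t \<sigma> = 1"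
  shows "t \<in> realization K"
proof -
  have sub: "{v. t v \<noteq> 0} \<subseteq> \<sigma>" using assms(4) by auto
  have fin: "finite \<sigma>" using abstract_complex_simplex(1)[OF assms(1,2)] .
  have s: "(\<Sum>v | t v \<noteq> 0. t v) = 1"
    using sum.mono_neutral_left[OF fin sub, of t] assms(5) by auto
  then have "{v. t v \<noteq> 0} \<noteq> {}" by (metis sum.empty zero_neq_one)
  then have "{v. t v \<noteq> 0} \<in> K"
    using abstract_complex_face[OF assms(1,2) sub] by simp
  then show ?thesis using assms(3) s by (auto simp: realization_def)
qed

lemma realizationE:
  assumes "abstract_complex K" "t \<in> realization K"
  obtains \<sigma> where "\<sigma> \<in> K" "finite \<sigma>" "\<sigma> = {v. t v \<noteq> 0}" "\<And>v. 0 \<le> t v" "sum t \<sigma> = 1"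
  using that[of "{v. t v \<noteq> 0}"] abstract_complex_simplex(1)[OF assms(1), of "{v. t v \<noteq> 0}"]
    assms(2)
  by (simp add: realization_def)

lemma realization_sum_superset:
  assumes "t \<in> realization K" "finite \<sigma>" "{v. t v \<noteq> 0} \<subseteq> \<sigma>"
  shows "sum t \<sigma> = 1"
proof -
  have "sum t {v. t v \<noteq> 0} = sum t \<sigma>"
    using assms(2,3) by (intro sum.mono_neutral_left) auto
  then show ?thesis using assms(1) by (simp add: realization_def)
qed

lemma realization_le_one:
  assumes "abstract_complex K" "t \<in> realization K"
  shows "t v \<le> 1"
  using assms(1,2)
proof (rule realizationE)
  fix \<sigma> assume *: "finite \<sigma>" "\<sigma> = {v. t v \<noteq> 0}" "\<And>v. 0 \<le> t v" "sum t \<sigma> = 1"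
  show ?thesis
    using member_le_sum[of v \<sigma> t] * by (cases "v \<in> \<sigma>") auto
qed

lemma realization_vanishes:
  assumes "t \<in> realization K" "v \<notin> \<Union>K"
  shows "t v = 0"
  using assms by (auto simp: realization_def)

lemma realization_Un: "realization (K \<union> M) = realization K \<union> realization M"
  by (auto simp: realization_def)

lemma closed_realization:
  assumes "abstract_complex K" "finite K"
  shows "closed (realization K)"
proof -
  \<comment> \<open>The closed simplex on \<sigma>: the support is only required to lie inside
    \<sigma>. Prescribing the exact support would give the open simplex, which is in general not
    closed.\<close>
  let ?S = "\<lambda>\<sigma>. {t::'a \<Rightarrow> real. (\<forall>v. 0 \<le> t v) \<and> (\<forall>v\<in>-\<sigma>. t v = 0) \<and> sum t \<sigma> = 1}"
  have "realization K = (\<Union>\<sigma>\<in>K. ?S \<sigma>)"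
  proof (intro set_eqI iffI)
    fix t assume "t \<in> realization K"
    with assms(1) show "t \<in> (\<Union>\<sigma>\<in>K. ?S \<sigma>)" by (rule realizationE) blast
  next
    fix t assume "t \<in> (\<Union>\<sigma>\<in>K. ?S \<sigma>)"
    then show "t \<in> realization K" using realizationI[OF assms(1)] by blast
  qed
  moreover have "closed (?S \<sigma>)" for \<sigma>
    unfolding Ball_def
    by (intro closed_Collect_conj closed_Collect_all closed_Collect_imp closed_Collect_eq
         closed_Collect_le continuous_intros continuous_on_product_coordinates) auto
  ultimately show ?thesis using assms(2) by auto
qed

text \<open>Tychonoff: the realization is a closed subset of the cube of all functions into the unit
  interval.\<close>

lemma compact_realization:
  assumes "abstract_complex K" "finite K"
  shows "compact (realization K)"
proof -
  have "compactin (product_topology (\<lambda>_. euclidean) UNIV) (Pi\<^sub>E UNIV (\<lambda>_::'a. {0..1::real}))"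
    by (subst compactin_PiE) auto
  then have "compact (Pi\<^sub>E UNIV (\<lambda>_::'a. {0..1::real}))"
    by (simp add: euclidean_product_topology)
  moreover have "realization K \<subseteq> Pi\<^sub>E UNIV (\<lambda>_. {0..1})"
    using assms(1) realization_le_one by (fastforce simp: realization_def)
  ultimately show ?thesis
    using closed_realization[OF assms] compact_Int_closed inf.absorb2 by metis
qed

section \<open>Coning off a contractible subcomplex\<close>

text \<open>The second summand is \<open>s\<close> times the vertex \<open>z\<close> in barycentric
  coordinates. If \<open>y\<close> vanishes at \<open>z\<close>, the height \<open>s\<close> can be
  read off as the \<open>z\<close> coordinate.\<close>

definition cone_point :: "'a \<Rightarrow> real \<Rightarrow> ('a \<Rightarrow> real) \<Rightarrow> 'a \<Rightarrow> real" where
  "cone_point z s y = (\<lambda>v. (1 - s) * y v + (if v = z then s else 0))"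

lemma cone_point_0 [simp]: "cone_point z 0 y = y"
  by (simp add: cone_point_def)

lemma cone_point_1: "cone_point z 1 y = cone_point z 1 y'"
  by (simp add: cone_point_def)

lemma continuous_on_cone_point:
  assumes "continuous_on S s" "continuous_on S y"
  shows "continuous_on S (\<lambda>x. cone_point z (s x) (y x))"
proof (rule continuous_on_coordinatewise_then_product)
  fix v
  have "continuous_on S (\<lambda>x. y x v)"
    using continuous_on_product_then_coordinatewise[OF assms(2)] .
  then show "continuous_on S (\<lambda>x. cone_point z (s x) (y x) v)"
    using assms(1) by (cases "v = z") (auto simp: cone_point_def intro!: continuous_intros)
qed

lemma cone_point_apex:
  assumes "y \<in> realization L" "z \<notin> \<Union>L"
  shows "cone_point z s y z = s"
  using realization_vanishes[OF assms] by (simp add: cone_point_def)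

lemma mem_cone_complex:
  "\<sigma> \<in> cone_complex z L \<longleftrightarrow> \<sigma> = {z} \<or> \<sigma> \<in> L \<or> (\<exists>\<tau>\<in>L. \<sigma> = insert z \<tau>)"
  by (auto simp: cone_complex_def)

text \<open>Removing \<open>z\<close> from a simplex of the cone leaves the empty set or a simplex
  of \<open>L\<close>. This property passes to faces, and adding \<open>z\<close> back stays in the
  cone.\<close>

lemma abstract_complex_cone:
  assumes "abstract_complex L"
  shows "abstract_complex (cone_complex z L)"
  unfolding abstract_complex_def
proof (intro conjI ballI allI impI)
  fix \<sigma> assume \<sigma>: "\<sigma> \<in> cone_complex z L"
  then show "finite \<sigma>" "\<sigma> \<noteq> {}"
    using assms by (auto simp: cone_complex_def abstract_complex_def)
  fix \<tau> assume \<tau>: "\<tau> \<subseteq> \<sigma> \<and> \<tau> \<noteq> {}"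
  have "\<sigma> - {z} = {} \<or> (\<exists>\<rho>\<in>L. \<sigma> - {z} \<subseteq> \<rho>)"
    using \<sigma> unfolding mem_cone_complex by auto
  moreover have "\<tau> - {z} \<subseteq> \<sigma> - {z}" using \<tau> by auto
  ultimately have "\<tau> - {z} = {} \<or> (\<exists>\<rho>\<in>L. \<tau> - {z} \<subseteq> \<rho>)"
    by (metis order_trans subset_empty)
  then have *: "\<tau> - {z} = {} \<or> \<tau> - {z} \<in> L"
    using assms unfolding abstract_complex_def by metis
  show "\<tau> \<in> cone_complex z L"
  proof (cases "z \<in> \<tau>")
    case True
    then have "\<tau> = insert z (\<tau> - {z})" by auto
    then show ?thesis using * unfolding mem_cone_complex by metis
  next
    case False
    then show ?thesis using * \<tau> by (simp add: mem_cone_complex)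
  qed
qed

lemma abstract_complex_Un:
  assumes "abstract_complex K" "abstract_complex M"
  shows "abstract_complex (K \<union> M)"
  using abstract_complex_simplex[OF assms(1)] abstract_complex_simplex[OF assms(2)]
    abstract_complex_face[OF assms(1)] abstract_complex_face[OF assms(2)]
  by (intro abstract_complexI) (simp only: Un_iff; metis)+

lemma finite_cone_complex: "finite L \<Longrightarrow> finite (cone_complex z L)"
  by (simp add: cone_complex_def flip: setcompr_eq_image)

lemma cone_point_in_realization:
  assumes "abstract_complex L" "z \<notin> \<Union>L" "y \<in> realization L" "s \<in> {0..1}"
  shows "cone_point z s y \<in> realization (cone_complex z L)"
  using assms(1,3)
proof (rule realizationE)
  fix \<sigma> assume \<sigma>: "\<sigma> \<in> L" "finite \<sigma>" "\<sigma> = {v. y v \<noteq> 0}" "\<And>v. 0 \<le> y v" "sum y \<sigma> = 1"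
  have z: "z \<notin> \<sigma>" "y z = 0" using assms(2) \<sigma>(1,3) by auto
  show ?thesis
  proof (rule realizationI[OF abstract_complex_cone[OF assms(1)]])
    show "{z} \<union> \<sigma> \<in> cone_complex z L" using \<sigma>(1) by (auto simp: cone_complex_def)
    show "0 \<le> cone_point z s y v" for v
      using \<sigma>(4)[of v] assms(4) by (simp add: cone_point_def)
    show "cone_point z s y v = 0" if "v \<notin> {z} \<union> \<sigma>" for v
      using that \<sigma>(3) by (auto simp: cone_point_def)
    have "sum (cone_point z s y) \<sigma> = (\<Sum>v\<in>\<sigma>. (1 - s) * y v)"
      using z(1) by (intro sum.cong) (auto simp: cone_point_def)
    also have "\<dots> = 1 - s" using \<sigma>(5) by (simp flip: sum_distrib_left)
    finally show "sum (cone_point z s y) ({z} \<union> \<sigma>) = 1"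
      using z \<sigma>(2) by (simp add: cone_point_def)
  qed
qed

text \<open>Away from the apex the base face carries positive weight, so \<open>t z < 1\<close> and
  rescaling by \<open>1 - t z\<close> recovers the base point. In the apex case \<open>y\<close> is
  arbitrary, since height 1 forgets it.\<close>

lemma realization_cone_cases:
  assumes "abstract_complex L" "z \<notin> \<Union>L" "t \<in> realization (cone_complex z L)"
  shows "t = cone_point z 1 y \<or> (\<exists>y\<in>realization L. \<exists>s\<in>{0..<1}. t = cone_point z s y)"
  using abstract_complex_cone[OF assms(1)] assms(3)
proof (rule realizationE)
  fix \<sigma> assume \<sigma>: "\<sigma> \<in> cone_complex z L" "finite \<sigma>" "\<sigma> = {v. t v \<noteq> 0}" "\<And>v. 0 \<le> t v" "sum t \<sigma> = 1"
  have sum1: "sum t (\<sigma> - {z}) = 1 - t z"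
    using \<sigma>(2,3,5) by (cases "z \<in> \<sigma>") (auto simp: sum_diff1)
  show ?thesis
  proof (cases "\<sigma> = {z}")
    case True
    then have "t z = 1" using \<sigma>(5) by simp
    moreover have "t v = 0" if "v \<noteq> z" for v using True \<sigma>(3) that by auto
    ultimately have "t = cone_point z 1 y" by (auto simp: cone_point_def)
    then show ?thesis ..
  next
    case False
    then have \<tau>: "\<sigma> - {z} \<in> L" using \<sigma>(1) assms(2) by (auto simp: cone_complex_def)
    then have "\<sigma> - {z} \<noteq> {}" using assms(1) unfolding abstract_complex_def by blast
    then have "sum t (\<sigma> - {z}) > 0"
      using \<sigma>(2,3,4) by (intro sum_pos) (auto simp: less_le)
    then have lt: "t z < 1" using sum1 by simp
    let ?y = "\<lambda>v. if v = z then 0 else t v / (1 - t z)"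
    have "sum ?y (\<sigma> - {z}) = (\<Sum>v\<in>\<sigma> - {z}. t v / (1 - t z))"
      by (intro sum.cong) auto
    also have "\<dots> = 1" using sum1 lt by (simp flip: sum_divide_distrib)
    finally have "?y \<in> realization L"
      using \<sigma>(3,4) lt by (intro realizationI[OF assms(1) \<tau>]) auto
    moreover have "t = cone_point z (t z) ?y"
      using lt by (auto simp: cone_point_def)
    ultimately show ?thesis using \<sigma>(4)[of z] lt by force
  qed
qed

lemma realization_cone:
  assumes "abstract_complex L" "z \<notin> \<Union>L" "realization L \<noteq> {}"
  shows "realization (cone_complex z L) = (\<lambda>(s, y). cone_point z s y) ` ({0..1} \<times> realization L)"
proof -
  \<comment> \<open>Some base point is required to write the apex as a point of height 1.\<close>
  obtain p where "p \<in> realization L" using assms(3) by auto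
  then have "t \<in> (\<lambda>(s, y). cone_point z s y) ` ({0..1} \<times> realization L)"
    if "t \<in> realization (cone_complex z L)" for t
    using realization_cone_cases[OF assms(1,2) that, of p] by force
  then show ?thesis using cone_point_in_realization[OF assms(1,2)] by auto
qed

text \<open>The cylinder over the base maps onto the cone by a quotient map that collapses only the
  top level \<open>s = 1\<close>. A map \<open>F\<close> independent of \<open>y\<close> there
  descends, with continuity at the apex supplied by compactness: the rescaled base coordinate itself
  has no limit there in general.\<close>

lemma homotopy_on_cone:
  fixes F :: "real \<times> real \<times> ('a \<Rightarrow> real) \<Rightarrow> 'b::topological_space"
  assumes "abstract_complex L" "finite L" "z \<notin> \<Union>L" "realization L \<noteq> {}"
    and contF: "continuous_on ({0..1} \<times> {0..1} \<times> realization L) F"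
    and apex: "\<And>u y y'. u \<in> {0..1} \<Longrightarrow> y \<in> realization L \<Longrightarrow> y' \<in> realization L \<Longrightarrow>
      F (u, 1, y) = F (u, 1, y')"
  obtains G where "continuous_on ({0..1} \<times> realization (cone_complex z L)) G"
    "\<And>u s y. u \<in> {0..1} \<Longrightarrow> s \<in> {0..1} \<Longrightarrow> y \<in> realization L \<Longrightarrow>
      G (u, cone_point z s y) = F (u, s, y)"
proof -
  obtain p where p: "p \<in> realization L" using assms(4) by auto
  \<comment> \<open>Recovers the base coordinate. At the apex it is undetermined; \<open>p\<close>
    is a default whose choice is immaterial by \<open>apex\<close>.\<close>
  let ?n = "\<lambda>t. if t z = 1 then p else (\<lambda>v. if v = z then 0 else t v / (1 - t z))"
  define G where "G = (\<lambda>(u, t). F (u, t z, ?n t))"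
  let ?q = "\<lambda>(u::real, s, y). (u, cone_point z s y)"
  let ?D = "{0..1::real} \<times> {0..1::real} \<times> realization L"
  have G: "G (u, cone_point z s y) = F (u, s, y)"
    if "u \<in> {0..1}" "s \<in> {0..1}" "y \<in> realization L" for u s y
  proof (cases "s = 1")
    case True
    then show ?thesis
      using apex[OF that(1) p that(3)] cone_point_apex[OF that(3) assms(3)] by (simp add: G_def)
  next
    case False
    have "y z = 0" using realization_vanishes[OF that(3) assms(3)] .
    then have "(\<lambda>v. if v = z then 0 else cone_point z s y v / (1 - s)) = y"
      using False by (auto simp: cone_point_def)
    moreover have "cone_point z s y z = s" using cone_point_apex[OF that(3) assms(3)] .
    ultimately show ?thesis using False by (simp only: G_def prod.case if_False)
  qed
  have "continuous_on ({0..1} \<times> realization (cone_complex z L)) G"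
  proof (rule continuous_on_compact_quotient[of ?D ?q])
    show "compact ?D" using compact_realization[OF assms(1,2)] by (intro compact_Times compact_Icc)
    show "continuous_on ?D ?q"
      unfolding case_prod_unfold
      by (intro continuous_on_Pair continuous_on_cone_point continuous_on_fst continuous_on_snd
            continuous_on_id)
    show "?q ` ?D = {0..1} \<times> realization (cone_complex z L)"
      unfolding realization_cone[OF assms(1,3,4)] by force
    show "Hausdorff_space (euclidean :: (real \<times> ('a \<Rightarrow> real)) topology)"
      unfolding prod_topology_euclidean[symmetric] Hausdorff_space_prod_topology
      using Hausdorff_space_euclidean_fun by auto
    show "continuous_on ?D (G \<circ> ?q)"
      using contF by (rule continuous_on_eq) (auto simp: G)
  qed
  with G that show thesis by blast
qed

lemma homotopy_eqv_cone_on_contractible: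
  assumes "abstract_complex K" "finite K" "abstract_complex L" "L \<subseteq> K" "z \<notin> \<Union>K"
    and "contractible_complex L"
  shows "realization (K \<union> cone_complex z L) homotopy_eqv realization K"
proof -
  have finL: "finite L" using assms(2,4) finite_subset by auto
  have zL: "z \<notin> \<Union>L" using assms(4,5) by auto
  have ne: "realization L \<noteq> {}" using assms(6) by (simp add: contractible_complex_def)
  have LK: "realization L \<subseteq> realization K" using assms(4) by (auto simp: realization_def)
  obtain H p where contH: "continuous_on ({0..1} \<times> realization L) H"
    and HL: "H \<in> {0..1} \<times> realization L \<rightarrow> realization L"
    and H0: "\<And>y. H (0::real, y) = y" and H1: "\<And>y. H (1, y) = p"
    using assms(6) unfolding contractible_complex_def contractible_def homotopic_with_def by auto
  let ?C = "cone_complex z L"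
  \<comment> \<open>At time \<open>u\<close>, \<open>a\<close> is how far the base point has been
    contracted and \<open>b\<close> is the height. Up to \<open>u = 1/2\<close>, \<open>a\<close>
    grows from 0 to \<open>s\<close> with \<open>b = s\<close>; afterwards \<open>a = s\<close> and
    \<open>b\<close> falls to 0. The factor \<open>s\<close> keeps the base \<open>s = 0\<close>
    fixed throughout.\<close>
  define a b :: "real \<Rightarrow> real \<Rightarrow> real"
    where "a = (\<lambda>u s. s * min 1 (2 * u))" and "b = (\<lambda>u s. s * min 1 (2 - 2 * u))"
  have ab: "a u s \<in> {0..1}" "b u s \<in> {0..1}" if "u \<in> {0..1}" "s \<in> {0..1}" for u s
    using that by (auto simp: a_def b_def intro!: mult_le_one)
  \<comment> \<open>Over \<open>s = 1\<close>, at every time either the contraction is complete and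
    gives \<open>p\<close>, or the height is 1 and \<open>y\<close> is forgotten. Hence
    \<open>F\<close> descends to the cone.\<close>
  have apex_ab: "a u 1 = 1 \<or> b u 1 = 1" for u by (auto simp: a_def b_def min_def)
  define F where "F = (\<lambda>(u, s, y). cone_point z (b u s) (H (a u s, y)))"
  have "continuous_on ({0..1} \<times> {0..1} \<times> realization L) F"
  proof -
    have "continuous_on ({0..1} \<times> {0..1} \<times> realization L)
        (\<lambda>x. H (a (fst x) (fst (snd x)), snd (snd x)))"
    proof (rule continuous_on_compose2[OF contH])
      show "continuous_on ({0..1} \<times> {0..1} \<times> realization L)
          (\<lambda>x. (a (fst x) (fst (snd x)), snd (snd x)))"
        unfolding a_def by (intro continuous_intros)
    qed (use ab in auto)
    then show ?thesis
      unfolding F_def b_def case_prod_unfold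
      by (intro continuous_on_cone_point) (intro continuous_intros)
  qed
  moreover have "F (u, 1, y) = F (u, 1, y')" for u y y'
    using apex_ab[of u] H1 cone_point_1[of z] by (auto simp: F_def)
  ultimately obtain G where contG: "continuous_on ({0..1} \<times> realization ?C) G"
    and G: "\<And>u s y. u \<in> {0..1} \<Longrightarrow> s \<in> {0..1} \<Longrightarrow> y \<in> realization L \<Longrightarrow>
      G (u, cone_point z s y) = F (u, s, y)"
    using homotopy_on_cone[OF assms(3) finL zL ne, of F] by metis
  \<comment> \<open>Points with \<open>t z = 0\<close> stay fixed. On the base of the cone
    \<open>F (u, 0, y) = H (0, y) = y\<close>, so the two rules agree there and \<open>h\<close> is
    continuous by gluing along two closed pieces.\<close>
  define h where "h = (\<lambda>(u, t). if t z = 0 then t else G (u, t))"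
  have hK: "h (u, t) = t" if "t \<in> realization K" for u t
    using realization_vanishes[OF that assms(5)] by (simp add: h_def)
  have hC: "h (u, cone_point z s y) = F (u, s, y)"
    if "u \<in> {0..1}" "s \<in> {0..1}" "y \<in> realization L" for u s y
  proof (cases "s = 0")
    case True
    then show ?thesis using hK[of y u] that(3) LK H0 by (auto simp: F_def a_def b_def)
  next
    case False
    then show ?thesis using G[OF that] cone_point_apex[OF that(3) zL] by (simp add: h_def)
  qed
  have hcases: "t \<in> realization K \<or>
      (\<exists>s\<in>{0..1}. \<exists>y\<in>realization L. t = cone_point z s y)"
    if "t \<in> realization (K \<union> ?C)" for t
    using that realization_cone[OF assms(3) zL ne] by (auto simp: realization_Un)
  have FC: "F (u, s, y) \<in> realization ?C"
    if "u \<in> {0..1}" "s \<in> {0..1}" "y \<in> realization L" for u s y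
  proof -
    have "H (a u s, y) \<in> realization L" using HL ab[OF that(1,2)] that(3) by blast
    then show ?thesis
      using cone_point_in_realization[OF assms(3) zL _ ab(2)[OF that(1,2)]] by (simp add: F_def)
  qed
  show ?thesis
  proof (rule homotopy_eqv_by_deformation)
    have "continuous_on ({0..1} \<times> realization K \<union> {0..1} \<times> realization ?C) h"
    proof (rule continuous_on_closed_Un)
      show "closed ({0..1::real} \<times> realization K)"
        using closed_realization[OF assms(1,2)] by (intro closed_Times) auto
      show "closed ({0..1::real} \<times> realization ?C)"
        using closed_realization[OF abstract_complex_cone[OF assms(3)] finite_cone_complex[OF finL]]
        by (intro closed_Times) auto
      have "continuous_on ({0..1::real} \<times> realization K) snd" by (intro continuous_intros)
      then show "continuous_on ({0..1} \<times> realization K) h"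
        by (rule continuous_on_eq) (auto simp: hK)
      show "continuous_on ({0..1} \<times> realization ?C) h"
        using contG by (rule continuous_on_eq) (auto simp: realization_cone[OF assms(3) zL ne] G hC)
    qed
    then show "continuous_on ({0..1} \<times> realization (K \<union> ?C)) h"
      by (simp add: realization_Un Sigma_Un_distrib2)
    show "h \<in> {0..1} \<times> realization (K \<union> ?C) \<rightarrow> realization (K \<union> ?C)"
      using hcases hK hC FC by (fastforce simp: realization_Un)
    show "realization K \<subseteq> realization (K \<union> ?C)" by (simp add: realization_Un)
    show "h (1, t) = t" if "t \<in> realization K" for t using hK that .
    fix t assume "t \<in> realization (K \<union> ?C)"
    then consider "t \<in> realization K" | s y where "s \<in> {0..1}" "y \<in> realization L" "t = cone_point z s y"
      using hcases by blast
    then have "h (0, t) = t \<and> h (1, t) \<in> realization K"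
    proof cases
      case 1
      then show ?thesis using hK by simp
    next
      case 2
      then have "F (0, s, y) = cone_point z s y" "F (1, s, y) = H (s, y)"
        by (auto simp: F_def a_def b_def H0)
      then show ?thesis using 2 hC HL LK by auto
    qed
    then show "h (0, t) = t" "h (1, t) \<in> realization K" by auto
  qed
qed

section \<open>Pushing weight onto a cone vertex\<close>

lemma homotopy_eqv_delete_vertices:
  assumes "abstract_complex K" "finite A" "z \<notin> A"
    and cone: "\<And>\<sigma>. \<sigma> \<in> K \<Longrightarrow> \<sigma> \<inter> A \<noteq> {} \<Longrightarrow> insert z \<sigma> \<in> K"
  shows "realization K homotopy_eqv realization (delete_vertices K A)"
proof -
  \<comment> \<open>\<open>r\<close> moves the total weight on \<open>A\<close> to \<open>z\<close>,
    and \<open>h\<close> runs along the segment from \<open>t\<close> to \<open>r t\<close>.\<close>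
  define r :: "('a \<Rightarrow> real) \<Rightarrow> 'a \<Rightarrow> real"
    where "r t = (\<lambda>v. (if v \<in> A then 0 else t v) + (if v = z then sum t A else 0))" for t
  define h :: "real \<times> ('a \<Rightarrow> real) \<Rightarrow> 'a \<Rightarrow> real"
    where "h = (\<lambda>(u, t) v. (1 - u) * t v + u * r t v)"
  have r_fix: "r t = t" if "\<And>v. v \<in> A \<Longrightarrow> t v = 0" for t
    using that by (auto simp: r_def fun_eq_iff)
  have hK: "h (u, t) \<in> realization K" if "u \<in> {0..1}" "t \<in> realization K" for u t
    using assms(1) that(2)
  proof (rule realizationE)
    fix \<sigma> assume \<sigma>: "\<sigma> \<in> K" "finite \<sigma>" "\<sigma> = {v. t v \<noteq> 0}" "\<And>v. 0 \<le> t v" "sum t \<sigma> = 1"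
    show ?thesis
    proof (cases "\<sigma> \<inter> A = {}")
      case True
      then have "r t = t" using \<sigma>(3) by (intro r_fix) auto
      then have "h (u, t) = t" by (simp add: h_def algebra_simps)
      then show ?thesis using that by simp
    next
      case False
      \<comment> \<open>By \<open>cone\<close> this is a simplex, and it carries both
        \<open>t\<close> and \<open>r t\<close>, hence the whole segment. The sums below check that
        weight is only moved, so the total remains 1.\<close>
      let ?\<rho> = "insert z \<sigma>"
      have fin: "finite ?\<rho>" using \<sigma>(2) by simp
      have t1: "sum t ?\<rho> = 1"
        using \<sigma>(3) by (intro realization_sum_superset[OF that(2) fin]) auto
      have "sum t A = sum t (?\<rho> \<inter> A)"
        using assms(2) \<sigma>(3) by (intro sum.mono_neutral_right) auto
      moreover have "(\<Sum>v\<in>?\<rho>. if v \<in> A then 0 else t v) = sum t (?\<rho> - A)"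
        using fin by (subst sum.mono_neutral_right[of ?\<rho> "?\<rho> - A"]) auto
      ultimately have "sum (r t) ?\<rho> = sum t ?\<rho>"
        using fin sum.Int_Diff[of ?\<rho> t A] by (simp add: r_def sum.distrib)
      then have "sum (h (u, t)) ?\<rho> = 1"
        using t1 by (simp add: h_def sum.distrib flip: sum_distrib_left)
      moreover have "0 \<le> r t v" for v
        using \<sigma>(4) by (auto simp: r_def sum_nonneg)
      then have "0 \<le> h (u, t) v" for v
        using that(1) \<sigma>(4) by (simp add: h_def)
      moreover have "h (u, t) v = 0" if "v \<notin> ?\<rho>" for v
        using that \<sigma>(3) by (auto simp: h_def r_def)
      ultimately show ?thesis
        using realizationI[OF assms(1) cone[OF \<sigma>(1) False]] by blast
    qed
  qed
  have del: "t \<in> realization (delete_vertices K A) \<longleftrightarrow> t \<in> realization K \<and> (\<forall>v\<in>A. t v = 0)" for t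
    by (auto simp: realization_def delete_vertices_def)
  show ?thesis
  proof (rule homotopy_eqv_by_deformation)
    have coord: "continuous_on S (\<lambda>x::real \<times> ('a \<Rightarrow> real). snd x v)" for S v
      by (rule continuous_on_product_then_coordinatewise[OF continuous_on_snd[OF continuous_on_id]])
    have "continuous_on S (\<lambda>x::real \<times> ('a \<Rightarrow> real). r (snd x) v)" for S v
      unfolding r_def
      by (cases "v \<in> A"; cases "v = z"; simp)
         (intro continuous_on_add continuous_on_sum continuous_on_const coord)+
    then show "continuous_on ({0..1} \<times> realization K) h"
      unfolding h_def case_prod_unfold
      by (intro continuous_on_coordinatewise_then_product continuous_on_add continuous_on_mult
            continuous_on_diff continuous_on_const continuous_on_fst continuous_on_id coord)
    show "h \<in> {0..1} \<times> realization K \<rightarrow> realization K" using hK by auto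
    show "h (0, t) = t" for t by (simp add: h_def)
    \<comment> \<open>Since \<open>z\<close> lies outside \<open>A\<close>, the weight arriving at
      \<open>z\<close> leaves all coordinates in \<open>A\<close> zero.\<close>
    show "h (1, t) \<in> realization (delete_vertices K A)" if "t \<in> realization K" for t
      using hK[of 1 t] that assms(3) by (auto simp: del) (auto simp: h_def r_def)
    show "realization (delete_vertices K A) \<subseteq> realization K" by (auto simp: del)
    show "h (1, t) = t" if "t \<in> realization (delete_vertices K A)" for t
      using that r_fix[of t] by (auto simp: del h_def)
  qed
qed

section \<open>Applying both deformations to the closed stars of \<open>A\<close>\<close>

theorem theorem4p3:
  fixes K L K' K'' :: "'a set set" and A :: "'a set" and z :: 'a
  assumes "abstract_complex K" and "finite K"
    and "finite A" and "A \<subseteq> vertices K"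
    and "L = (\<Union>x\<in>A. comb_closure K (star K {x}))"
    and "z \<notin> vertices K"
    and "K' = K \<union> cone_complex z L"
    and "K'' = delete_vertices K' A"
    and "contractible_complex L"
  shows "homotopy_equivalent_complexes K K' \<and>
         homotopy_equivalent_complexes K' K'' \<and>
         homotopy_equivalent_complexes K K''"
proof -
  \<comment> \<open>If \<open>z\<close> lay in any simplex, its singleton would be a face, making
    \<open>z\<close> a vertex.\<close>
  have zK: "z \<notin> \<Union>K"
    using assms(1,6) by (auto simp: abstract_complex_def vertices_def)
  have L: "L \<subseteq> K"
    unfolding assms(5) comb_closure_def by auto
  have "\<tau> \<in> L" if \<sigma>: "\<sigma> \<in> L" and \<tau>: "\<tau> \<subseteq> \<sigma>" "\<tau> \<noteq> {}" for \<sigma> \<tau>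
  proof -
    have "\<tau> \<in> K" using L \<sigma> abstract_complex_face[OF assms(1) _ \<tau>] by blast
    moreover obtain x \<rho> where "x \<in> A" "\<rho> \<in> star K {x}" "\<sigma> \<subseteq> \<rho>"
      using \<sigma> unfolding assms(5) comb_closure_def by blast
    moreover from this have "\<tau> \<subseteq> \<rho>" using \<tau>(1) by simp
    ultimately show ?thesis
      unfolding assms(5) comb_closure_def by blast
  qed
  then have absL: "abstract_complex L"
    using abstract_complex_simplex[OF assms(1)] L by (intro abstract_complexI) auto
  \<comment> \<open>A simplex containing some \<open>x\<close> in \<open>A\<close> belongs to the
    star of \<open>x\<close>, so coning off \<open>L\<close> cones off every simplex that meets
    \<open>A\<close>.\<close>
  have star: "\<sigma> \<in> L" if "\<sigma> \<in> K" "\<sigma> \<inter> A \<noteq> {}" for \<sigma>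
    using that unfolding assms(5) comb_closure_def star_def by blast
  have K'K: "realization K' homotopy_eqv realization K"
    unfolding assms(7) by (rule homotopy_eqv_cone_on_contractible[OF assms(1,2) absL L zK assms(9)])
  have K': "abstract_complex K'"
    unfolding assms(7) by (intro abstract_complex_Un abstract_complex_cone assms(1) absL)
  have zA: "z \<notin> A" using assms(4,6) by auto
  have "insert z \<sigma> \<in> K'" if "\<sigma> \<in> K'" "\<sigma> \<inter> A \<noteq> {}" for \<sigma>
  proof -
    \<comment> \<open>A simplex of \<open>K'\<close> avoiding \<open>z\<close> already lies in
      \<open>K\<close>; meeting \<open>A\<close> then forces it into \<open>L\<close>, where its
      join with \<open>z\<close> is available. If it contains \<open>z\<close>, inserting
      \<open>z\<close> changes nothing.\<close>
    have "\<sigma> \<in> L \<or> z \<in> \<sigma>"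
      using that star unfolding assms(7) Un_iff mem_cone_complex by auto
    then show ?thesis
      using that(1) unfolding assms(7) Un_iff mem_cone_complex by (auto simp: insert_absorb)
  qed
  then have K'K'': "realization K' homotopy_eqv realization K''"
    unfolding assms(8) by (rule homotopy_eqv_delete_vertices[OF K' assms(3) zA])
  show ?thesis
    unfolding homotopy_equivalent_complexes_def
    using K'K K'K'' homotopy_equivalent_space_sym homotopy_eqv_trans by blast
qed

end
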